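(* Let $F$ be either a non-Archimedean local field of characteristic zero or $F=\mathbb R$, and $\psi:F\to\mathbb C^\times$ a nontrivial additive character. Let $V_k$ be an even-dimensional nondegenerate quadratic space over $F$ and $V_{k+1}$ the orthogonal sum of $V_k$ and a hyperbolic plane. If $F$ is non-Archimedean assume that $\dim V_k\ge6$ and that the Witt index of $V_{k+1}$ is at least $\dim V_k/2$. Let $C_k\subset V_k$ be the zero locus of the quadratic form, and let $\omega:C_k\to V_k$ be the inclusion, with the action of $H=\mathbb{G}_m\times\mathrm{GO}_{V_k}$ given by $v(a,h)=avh$. Then $$\Psi_\omega\{F\}=\widetilde\tau(\mathrm{GO}_{V_{k+1}}(F)).$$
   Context: Write row vectors and right actions. Let $J_k$ be the symmetric matrix of the quadratic form $\mathcal Q_k$ of $V_k$, $\langle v,v'\rangle_k=vJ_kv'^t$, $\mathcal Q_k(v)=\tfrac12\langle v,v\rangle_k$, $d=\dim V_k$, and realize $V_{k+1}=\mathbb{G}_a\oplus V_k\oplus\mathbb{G}_a$ with matrix $J_{k+1}=\begin{pmatrix}&&1\\&J_k&\\1&&\end{pmatrix}$. $\mathrm O$, $\mathrm{GO}$ denote orthogonal and orthogonal similitude groups, $\nu$ the similitude norm. For $a\in F^\times$, $g\in\mathrm{GO}_{V_k}(F)$, $v\in V_k(F)$ put $$m(a,g)=\begin{pmatrix}a\nu(g)&&\\&g&\\&&a^{-1}\end{pmatrix},\quad n(v)=\begin{pmatrix}1&v&-\mathcal Q_k(v)\\&I&-J_kv^t\\&&1\end{pmatrix},\quad w_0=\begin{pmatrix}&&1\\&I&\\1&&\end{pmatrix}.$$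 $C_k^\circ=C_k-\{0\}$; $L^2(C_k^\circ(F))$ is taken with respect to the measure $|\omega_{C_k}|$, where $dv_1\wedge\cdots\wedge dv_d=d\mathcal Q_k\wedge\omega_{C_k}$ (multiplication by $|\omega_{C_k}|^{1/2}$ identifies it with $L^2$ half-densities). Character $\chi$. If $F$ is non-Archimedean, $\chi:F^\times\to\mathbb C^\times$ is the character associated by class field theory to $F(\sqrt{\det J_k})/F$. If $F=\mathbb R$ and $\mathcal Q_k$ has signature $(p,q)$, $\chi$ is trivial on $\mathbb R_{>0}$ and equals $(-1)^{(p-q)/2}$ on $\mathbb R_{<0}$. Minimal representation. Let $\widetilde Q_k(F)=\{m(a,g)n(v)\}\le\mathrm{GO}_{V_{k+1}}(F)$, a parabolic subgroup, acting by $$\widetilde\tau(n(v)m(a,g))f(c)=\psi(\langle v,c\rangle_k)\,\chi(a)|a|^{(d-2)/2}|\nu(g)|^{(d-2)/4}f(acg).$$ Its restriction to the subgroup with $g\in\mathrm O_{V_k}(F)$ extends to a unitary representation $\tau$ of $\mathrm O_{V_{k+1}}(F)$ on $L^2(C_k^\circ(F))$, the minimal representation (Gurevich–Kazhdan for $F$ non-Archimedean, Kobayashi–Mano for $F=\mathbb R$). The representation $\widetilde\tau$ extends to a unitary representation of $\mathrm{GO}_{V_{k+1}}(F)$ on $L^2(C_k^\circ(F))$, still denoted $\widetilde\tau$, with $\widetilde\tau|_{\mathrm O_{V_{k+1}}(F)}=\tau$, given by $\widetilde\tau(m(a,g)h)=\widetilde\tau(m(a,g))\tau(h)$ for $h\in\mathrm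 O_{V_{k+1}}(F)$. Modulation group. Let $H_X=\{(\lambda^{-1},\lambda I_{V_k})\}\cong\mathbb{G}_m$ be the kernel of the action of $H$ on $C_k$. The small modulation group is $\Psi^{\mathrm s}_\omega=V_k\rtimes(\mathbb{G}_m\times\mathrm{GO}_{V_k})/H_X$, where $V_k$ is identified with its dual by $\langle\,,\,\rangle_k$. Consider the action $\mathcal R_{\omega,\chi}$ of $\Psi^{\mathrm s}_\omega(F)$ on $L^2(C_k^\circ(F))$ given by $$\mathcal R_{\omega,\chi}((v,m(a,h)))f(c)=\psi(\langle v,c\rangle_k)\chi(a)|a|^{(d-2)/2}|\nu(h)|^{(d-2)/4}f(ach),\quad (a,h)\in F^\times\times\mathrm{GO}_{V_k}(F).$$ The Fourier transform is $\mathcal F_C:=\widetilde\tau(w_0)$, and the modulation group of $\omega$ is the group of unitary operators on $L^2(C_k^\circ(F))$ $$\Psi_\omega\{F\}:=\langle\mathcal F_C,\ \mathcal R_{\omega,\chi}(\Psi^{\mathrm s}_\omega(F))\rangle.$$ *)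

theory Defs
  imports "HOL-Analysis.Analysis" "HOL-Algebra.Bij" "HOL-Algebra.Generated_Groups"
begin

section \<open>Local fields\<close>

text \<open>
  The ground field is a type of sort \<open>{field_char_0, complete_space}\<close>. The two predicates below say
  that it is a non-Archimedean local field, respectively the field of real numbers, and that
  the metric is \<open>\<bar>x - y\<bar>\<close> for the normalized absolute value (the module of the field), which is thus
  recovered as the distance to \<open>0\<close>. (The library constant \<open>norm\<close> requires a real vector space.)
\<close>

definition absval :: "'F::{field_char_0, complete_space} \<Rightarrow> real" where
  "absval x = dist x 0"

definition residue_classes :: "'F::{field_char_0, complete_space} set set" where
  "residue_classes = (\<lambda>x. {y. absval (y - x) < 1}) ` {x. absval x \<le> 1}"

definition nonarch_local_field :: "'F::{field_char_0, complete_space} itself \<Rightarrow> bool" where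
  "nonarch_local_field _ \<longleftrightarrow>
     (\<forall>x y :: 'F. dist x y = absval (x - y)) \<and>
     (\<forall>x y :: 'F. absval (x * y) = absval x * absval y) \<and>
     (\<forall>x y :: 'F. absval (x + y) \<le> max (absval x) (absval y)) \<and>
     finite (residue_classes :: 'F set set) \<and>
     (\<exists>p :: 'F. p \<noteq> 0 \<and> absval p < 1 \<and> (\<forall>x :: 'F. absval x < 1 \<longrightarrow> absval x \<le> absval p) \<and>
        absval p = 1 / real (card (residue_classes :: 'F set set)))"

definition is_real_field :: "'F::{field_char_0, complete_space} itself \<Rightarrow> bool" where
  "is_real_field _ \<longleftrightarrow>
     (\<exists>\<phi> :: 'F \<Rightarrow> real. bij \<phi> \<and> (\<forall>x y. \<phi> (x + y) = \<phi> x + \<phi> y) \<and>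
        (\<forall>x y. \<phi> (x * y) = \<phi> x * \<phi> y) \<and> (\<forall>x y. dist x y = \<bar>\<phi> x - \<phi> y\<bar>))"

definition additive_character :: "('F::{field_char_0, complete_space} \<Rightarrow> complex) \<Rightarrow> bool" where
  "additive_character \<psi> \<longleftrightarrow>
     continuous_on UNIV \<psi> \<and> (\<forall>x. cmod (\<psi> x) = 1) \<and> (\<forall>x y. \<psi> (x + y) = \<psi> x * \<psi> y)"

definition haar_measure :: "'F::{field_char_0, complete_space} measure \<Rightarrow> bool" where
  "haar_measure \<nu> \<longleftrightarrow>
     sets \<nu> = sets borel \<and>
     (\<forall>a. \<forall>A \<in> sets borel. emeasure \<nu> ((\<lambda>x. a + x) ` A) = emeasure \<nu> A) \<and>
     (\<forall>K. compact K \<longrightarrow> emeasure \<nu> K < \<infinity>) \<and>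
     (\<forall>U. open U \<longrightarrow> U \<noteq> {} \<longrightarrow> 0 < emeasure \<nu> U)"


section \<open>Quadratic spaces\<close>

text \<open>
  A quadratic space is \<open>'F ^ 'n\<close> (row vectors) with the Gram matrix \<open>J\<close> of its bilinear form;
  matrices act on the right, by \<open>v*\<close>.
\<close>

definition form :: "'F::field ^ 'n ^ 'n \<Rightarrow> 'F ^ 'n \<Rightarrow> 'F ^ 'n \<Rightarrow> 'F" where
  "form J v w = (\<Sum>i\<in>UNIV. \<Sum>j\<in>UNIV. v $ i * J $ i $ j * w $ j)"

definition qform :: "'F::field ^ 'n ^ 'n \<Rightarrow> 'F ^ 'n \<Rightarrow> 'F" where
  "qform J v = form J v v / 2"

definition nondegenerate :: "'F::field ^ 'n ^ 'n \<Rightarrow> bool" where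
  "nondegenerate J \<longleftrightarrow> transpose J = J \<and> det J \<noteq> 0"

definition witt_index :: "'F::field ^ 'n ^ 'n \<Rightarrow> nat" where
  "witt_index J = Max {vec.dim W | W. vec.subspace W \<and> (\<forall>v\<in>W. \<forall>w\<in>W. form J v w = 0)}"

definition is_similitude :: "'F::field ^ 'n ^ 'n \<Rightarrow> 'F \<Rightarrow> 'F ^ 'n ^ 'n \<Rightarrow> bool" where
  "is_similitude J c g \<longleftrightarrow> c \<noteq> 0 \<and> (\<forall>v w. form J (v v* g) (w v* g) = c * form J v w)"

definition similitude_norm :: "'F::field ^ 'n ^ 'n \<Rightarrow> 'F ^ 'n ^ 'n \<Rightarrow> 'F" where
  "similitude_norm J g = (THE c. is_similitude J c g)"

definition GO :: "'F::field ^ 'n ^ 'n \<Rightarrow> ('F ^ 'n ^ 'n) monoid" where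
  "GO J = \<lparr>carrier = {g. \<exists>c. is_similitude J c g}, mult = (**), one = mat 1\<rparr>"

definition Orth :: "'F::field ^ 'n ^ 'n \<Rightarrow> ('F ^ 'n ^ 'n) monoid" where
  "Orth J = GO J\<lparr>carrier := {g. is_similitude J 1 g}\<rparr>"


section \<open>Adding a hyperbolic plane\<close>

datatype 'n hyp = First | Mid 'n | Last

lemma UNIV_hyp: "(UNIV :: 'n hyp set) = insert First (insert Last (range Mid))"
proof -
  have "x \<in> insert First (insert Last (range Mid))" for x :: "'n hyp"
    by (cases x) auto
  then show ?thesis by auto
qed

instance hyp :: (finite) finite
  by standard (simp add: UNIV_hyp)

text \<open>Entries are listed row by row.\<close>

definition block ::
  "'F \<Rightarrow> 'F ^ 'n \<Rightarrow> 'F \<Rightarrow> 'F ^ 'n \<Rightarrow> 'F ^ 'n ^ 'n \<Rightarrow> 'F ^ 'n \<Rightarrow> 'F \<Rightarrow> 'F ^ 'n \<Rightarrow> 'F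
     \<Rightarrow> 'F ^ 'n hyp ^ 'n hyp" where
  "block a11 r12 a13 c21 A22 c23 a31 r32 a33 = (\<chi> i j.
     case i of
       First \<Rightarrow> (case j of First \<Rightarrow> a11 | Mid l \<Rightarrow> r12 $ l | Last \<Rightarrow> a13)
     | Mid k \<Rightarrow> (case j of First \<Rightarrow> c21 $ k | Mid l \<Rightarrow> A22 $ k $ l | Last \<Rightarrow> c23 $ k)
     | Last \<Rightarrow> (case j of First \<Rightarrow> a31 | Mid l \<Rightarrow> r32 $ l | Last \<Rightarrow> a33))"

definition hyp_ext :: "'F::field ^ 'n ^ 'n \<Rightarrow> 'F ^ 'n hyp ^ 'n hyp" where
  "hyp_ext J = block 0 0 1
                     0 J 0
                     1 0 0"

definition m_mat :: "'F::field ^ 'n ^ 'n \<Rightarrow> 'F \<Rightarrow> 'F ^ 'n ^ 'n \<Rightarrow> 'F ^ 'n hyp ^ 'n hyp" where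
  "m_mat J a g = block (a * similitude_norm J g) 0 0
                       0                         g 0
                       0                         0 (inverse a)"

definition n_mat :: "'F::field ^ 'n ^ 'n \<Rightarrow> 'F ^ 'n \<Rightarrow> 'F ^ 'n hyp ^ 'n hyp" where
  "n_mat J v = block 1 v       (- qform J v)
                     0 (mat 1) (- (J *v v))
                     0 0       1"

definition w0 :: "'F::field ^ ('n::finite) hyp ^ 'n hyp" where
  "w0 = block 0 0       1
              0 (mat 1) 0
              1 0       0"


section \<open>The cone and its measure\<close>

definition cone :: "'F::field ^ 'n ^ 'n \<Rightarrow> ('F ^ 'n) set" where
  "cone J = {c. qform J c = 0}"

definition cone0 :: "'F::field ^ 'n ^ 'n \<Rightarrow> ('F ^ 'n) set" where
  "cone0 J = cone J - {0}"

text \<open>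
  The form \<open>\<omega>\<close> with \<open>dv\<^sub>1 \<and> \<dots> \<and> dv\<^sub>d = d\<Q> \<and> \<omega>\<close> is, on the open set of the cone where the partial
  derivative \<open>\<partial>\<^sub>i\<Q>(c) = (J c)\<^sub>i\<close> does not vanish, equal to \<open>\<plusminus> (\<partial>\<^sub>i\<Q>)\<inverse>\<close> times the wedge of the \<open>dv\<^sub>j\<close> with
  \<open>j \<noteq> i\<close>. There the coordinates \<open>v\<^sub>j\<close> (\<open>j \<noteq> i\<close>) are local coordinates on the cone (with at most two
  points of the cone over each value), so \<open>|\<omega>|\<close> is the measure given by the formula below.
  These open sets cover the punctured cone, so that \<open>|\<omega>|\<close> is determined by these conditions.
\<close>

definition cone_measure ::
  "'F::{field_char_0, complete_space} measure \<Rightarrow> 'F ^ 'n ^ 'n \<Rightarrow> ('F ^ 'n) measure \<Rightarrow> bool" where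
  "cone_measure \<nu> J \<mu> \<longleftrightarrow>
     space \<mu> = cone0 J \<and> sets \<mu> = sets (restrict_space borel (cone0 J)) \<and>
     (\<forall>i. \<forall>A \<in> sets \<mu>. (\<forall>c\<in>A. (J *v c) $ i \<noteq> 0) \<longrightarrow>
        emeasure \<mu> A =
          (\<integral>\<^sup>+ y. (\<Sum>c \<in> {c\<in>A. \<forall>j. j \<noteq> i \<longrightarrow> c $ j = y j}. ennreal (1 / absval ((J *v c) $ i)))
             \<partial>(PiM (UNIV - {i}) (\<lambda>_. \<nu>))))"


section \<open>The Hilbert space of square integrable functions and its unitary operators\<close>

definition sqint :: "'a measure \<Rightarrow> ('a \<Rightarrow> complex) \<Rightarrow> bool" where
  "sqint M f \<longleftrightarrow> f \<in> borel_measurable M \<and> integrable M (\<lambda>x. (cmod (f x))\<^sup>2)"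

definition l2_class :: "'a measure \<Rightarrow> ('a \<Rightarrow> complex) \<Rightarrow> ('a \<Rightarrow> complex) set" where
  "l2_class M f = {g. sqint M g \<and> (AE x in M. g x = f x)}"

definition L2 :: "'a measure \<Rightarrow> ('a \<Rightarrow> complex) set set" where
  "L2 M = l2_class M ` {f. sqint M f}"

definition l2_rep :: "('a \<Rightarrow> complex) set \<Rightarrow> 'a \<Rightarrow> complex" where
  "l2_rep X = (SOME f. f \<in> X)"

definition l2_add :: "'a measure \<Rightarrow> ('a \<Rightarrow> complex) set \<Rightarrow> ('a \<Rightarrow> complex) set \<Rightarrow> ('a \<Rightarrow> complex) set" where
  "l2_add M X Y = l2_class M (\<lambda>x. l2_rep X x + l2_rep Y x)"

definition l2_scale :: "'a measure \<Rightarrow> complex \<Rightarrow> ('a \<Rightarrow> complex) set \<Rightarrow> ('a \<Rightarrow> complex) set" where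
  "l2_scale M z X = l2_class M (\<lambda>x. z * l2_rep X x)"

definition l2_inner :: "'a measure \<Rightarrow> ('a \<Rightarrow> complex) set \<Rightarrow> ('a \<Rightarrow> complex) set \<Rightarrow> complex" where
  "l2_inner M X Y = (\<integral>x. l2_rep X x * cnj (l2_rep Y x) \<partial>M)"

definition l2_dist :: "'a measure \<Rightarrow> ('a \<Rightarrow> complex) set \<Rightarrow> ('a \<Rightarrow> complex) set \<Rightarrow> real" where
  "l2_dist M X Y = sqrt (\<integral>x. (cmod (l2_rep X x - l2_rep Y x))\<^sup>2 \<partial>M)"

definition l2_operator ::
  "'a measure \<Rightarrow> (('a \<Rightarrow> complex) \<Rightarrow> 'a \<Rightarrow> complex) \<Rightarrow> ('a \<Rightarrow> complex) set \<Rightarrow> ('a \<Rightarrow> complex) set" where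
  "l2_operator M \<Phi> = (\<lambda>X\<in>L2 M. l2_class M (\<Phi> (l2_rep X)))"

definition unitary_group :: "'a measure \<Rightarrow> (('a \<Rightarrow> complex) set \<Rightarrow> ('a \<Rightarrow> complex) set) monoid" where
  "unitary_group M = BijGroup (L2 M)\<lparr>carrier := {T \<in> Bij (L2 M).
     (\<forall>X\<in>L2 M. \<forall>Y\<in>L2 M. T (l2_add M X Y) = l2_add M (T X) (T Y)) \<and>
     (\<forall>z. \<forall>X\<in>L2 M. T (l2_scale M z X) = l2_scale M z (T X)) \<and>
     (\<forall>X\<in>L2 M. \<forall>Y\<in>L2 M. l2_inner M (T X) (T Y) = l2_inner M X Y)}\<rparr>"

text \<open>Unitary representations are strongly continuous, as usual.\<close>

definition unitary_rep ::
  "('g::topological_space) monoid \<Rightarrow> 'a measure \<Rightarrow>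
     ('g \<Rightarrow> ('a \<Rightarrow> complex) set \<Rightarrow> ('a \<Rightarrow> complex) set) \<Rightarrow> bool" where
  "unitary_rep G M \<rho> \<longleftrightarrow>
     \<rho> \<in> hom G (unitary_group M) \<and>
     (\<forall>X\<in>L2 M. \<forall>g\<in>carrier G.
        ((\<lambda>h. l2_dist M (\<rho> h X) (\<rho> g X)) \<longlongrightarrow> 0) (at g within carrier G))"


section \<open>The character\<close>

text \<open>\<open>norm_group D\<close> is the group of norms from \<open>F(\<surd>D)\<close> to \<open>F\<close>, which is \<open>F\<^sup>\<times>\<close> if \<open>D\<close> is a square.\<close>

definition norm_group :: "'F::field \<Rightarrow> 'F set" where
  "norm_group D =
     (if \<exists>s. D = s\<^sup>2 then UNIV - {0} else {x\<^sup>2 - D * y\<^sup>2 | x y. True} - {0})"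

text \<open>
  The reciprocity map identifies \<open>F\<^sup>\<times>\<close> modulo norms with the Galois group, so the character of
  \<open>F(\<surd>D)/F\<close> is the character with values in \<open>{1, -1}\<close> whose kernel is the norm group.
\<close>

definition cft_character :: "'F::field \<Rightarrow> 'F \<Rightarrow> complex" where
  "cft_character D a = (if a \<in> norm_group D then 1 else - 1)"

definition has_signature :: "'F::field ^ 'n ^ 'n \<Rightarrow> nat \<Rightarrow> nat \<Rightarrow> bool" where
  "has_signature J p q \<longleftrightarrow>
     (\<exists>(P :: 'F ^ 'n ^ 'n) (S :: 'n set). invertible P \<and> card S = p \<and> card (- S) = q \<and>
        P ** J ** transpose P = (\<chi> i j. if i = j then (if i \<in> S then 1 else - 1) else 0))"

text \<open>In a field isomorphic to the reals, the positive elements are the nonzero squares.\<close>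

definition real_character :: "'F::field ^ 'n ^ 'n \<Rightarrow> 'F \<Rightarrow> complex" where
  "real_character J a =
     (if \<exists>s. s \<noteq> 0 \<and> a = s\<^sup>2 then 1
      else (let (p, q) = (THE (p, q). has_signature J p q) in (- 1) powi ((int p - int q) div 2)))"

definition chi :: "'F::{field_char_0, complete_space} ^ 'n ^ 'n \<Rightarrow> 'F \<Rightarrow> complex" where
  "chi J = (if nonarch_local_field TYPE('F) then cft_character (det J) else real_character J)"


section \<open>The minimal representation\<close>

text \<open>
  The formula that gives both the action of \<open>n(v) m(a,h)\<close> in the parabolic subgroup and
  the action of \<open>(v, m(a,h))\<close> in the small modulation group.
\<close>

definition act ::
  "('F::{field_char_0, complete_space} \<Rightarrow> complex) \<Rightarrow> 'F ^ 'n ^ 'n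
     \<Rightarrow> ('F ^ 'n) \<times> 'F \<times> ('F ^ 'n ^ 'n) \<Rightarrow> ('F ^ 'n \<Rightarrow> complex) \<Rightarrow> 'F ^ 'n \<Rightarrow> complex" where
  "act \<psi> J = (\<lambda>(v, a, h) f c.
     \<psi> (form J v c) * chi J a *
     complex_of_real (absval a powr ((real CARD('n) - 2) / 2)) *
     complex_of_real (absval (similitude_norm J h) powr ((real CARD('n) - 2) / 4)) *
     f (a *s (c v* h)))"

text \<open>
  The minimal representation (Gurevich--Kazhdan, Kobayashi--Mano) is specified by its defining property:
  it is a unitary representation of the orthogonal group that extends the explicit action of
  the parabolic subgroup. Its existence is not proved here; \<open>minimal_rep\<close> and \<open>similitude_extension\<close>
  are predicates on operator-valued functions.
\<close>

definition minimal_rep ::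
  "('F::{field_char_0, complete_space} \<Rightarrow> complex) \<Rightarrow> 'F ^ 'n ^ 'n \<Rightarrow> ('F ^ 'n) measure
     \<Rightarrow> ('F ^ 'n hyp ^ 'n hyp \<Rightarrow> ('F ^ 'n \<Rightarrow> complex) set \<Rightarrow> ('F ^ 'n \<Rightarrow> complex) set) \<Rightarrow> bool" where
  "minimal_rep \<psi> J \<mu> \<tau> \<longleftrightarrow>
     unitary_rep (Orth (hyp_ext J)) \<mu> \<tau> \<and>
     (\<forall>v a. \<forall>g \<in> carrier (Orth J). a \<noteq> 0 \<longrightarrow>
        \<tau> (n_mat J v ** m_mat J a g) = l2_operator \<mu> (act \<psi> J (v, a, g)))"

definition similitude_extension ::
  "('F::{field_char_0, complete_space} \<Rightarrow> complex) \<Rightarrow> 'F ^ 'n ^ 'n \<Rightarrow> ('F ^ 'n) measure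
     \<Rightarrow> ('F ^ 'n hyp ^ 'n hyp \<Rightarrow> ('F ^ 'n \<Rightarrow> complex) set \<Rightarrow> ('F ^ 'n \<Rightarrow> complex) set)
     \<Rightarrow> ('F ^ 'n hyp ^ 'n hyp \<Rightarrow> ('F ^ 'n \<Rightarrow> complex) set \<Rightarrow> ('F ^ 'n \<Rightarrow> complex) set) \<Rightarrow> bool" where
  "similitude_extension \<psi> J \<mu> \<tau> \<tau>' \<longleftrightarrow>
     unitary_rep (GO (hyp_ext J)) \<mu> \<tau>' \<and>
     (\<forall>v a. \<forall>g \<in> carrier (GO J). a \<noteq> 0 \<longrightarrow>
        \<tau>' (n_mat J v ** m_mat J a g) = l2_operator \<mu> (act \<psi> J (v, a, g))) \<and>
     (\<forall>h \<in> carrier (Orth (hyp_ext J)). \<tau>' h = \<tau> h) \<and>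
     (\<forall>a. \<forall>g \<in> carrier (GO J). \<forall>h \<in> carrier (Orth (hyp_ext J)). a \<noteq> 0 \<longrightarrow>
        \<tau>' (m_mat J a g ** h) = \<tau>' (m_mat J a g) \<otimes>\<^bsub>unitary_group \<mu>\<^esub> \<tau> h)"


section \<open>The modulation group\<close>

text \<open>
  The semidirect product of \<open>V\<close> with \<open>F\<^sup>\<times> \<times> GO(V)\<close>. Here \<open>V\<close> is the dual of \<open>V\<close>: the functional
  \<open>c \<mapsto> \<langle>v, a c h\<rangle>\<close> corresponds to the vector \<open>a \<nu>(h) v h\<inverse>\<close>.
\<close>

definition Psi_pre ::
  "'F::field ^ 'n ^ 'n \<Rightarrow> (('F ^ 'n) \<times> 'F \<times> ('F ^ 'n ^ 'n)) monoid" where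
  "Psi_pre J = \<lparr>carrier = UNIV \<times> (UNIV - {0}) \<times> carrier (GO J),
     mult = (\<lambda>(v, a, h) (v', a', h').
       (v + (a * similitude_norm J h) *s (v' v* matrix_inv h), a * a', h ** h')),
     one = (0, 1, mat 1)\<rparr>"

definition H_X :: "(('F::field ^ 'n) \<times> 'F \<times> ('F ^ 'n ^ 'n)) set" where
  "H_X = {(0, inverse l, mat l) | l. l \<noteq> 0}"

text \<open>\<open>H_X\<close> acts trivially on \<open>V\<close>, so it may be divided out after forming the semidirect product.\<close>

definition Psi_small ::
  "'F::field ^ 'n ^ 'n \<Rightarrow> (('F ^ 'n) \<times> 'F \<times> ('F ^ 'n ^ 'n)) set monoid" where
  "Psi_small J = Psi_pre J Mod H_X"

text \<open>
  The element \<open>(\<lambda>\<inverse>, \<lambda> I)\<close> of \<open>H_X\<close> acts by the scalar \<open>\<chi>(\<lambda>\<inverse>)\<close>, so that an element of the small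
  modulation group determines its operator up to the sign \<open>\<chi>(\<lambda>)\<close>. The image of the small modulation
  group is the set of all operators given by the formula, over all representatives \<open>(v, (a, h))\<close>.
\<close>

definition R_image ::
  "('F::{field_char_0, complete_space} \<Rightarrow> complex) \<Rightarrow> 'F ^ 'n ^ 'n \<Rightarrow> ('F ^ 'n) measure
     \<Rightarrow> (('F ^ 'n \<Rightarrow> complex) set \<Rightarrow> ('F ^ 'n \<Rightarrow> complex) set) set" where
  "R_image \<psi> J \<mu> =
     (\<Union>K \<in> carrier (Psi_small J). (\<lambda>x. l2_operator \<mu> (act \<psi> J x)) ` K)"

definition fourier_transform ::
  "('F::field ^ 'n hyp ^ 'n hyp \<Rightarrow> ('F ^ 'n \<Rightarrow> complex) set \<Rightarrow> ('F ^ 'n \<Rightarrow> complex) set)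
     \<Rightarrow> ('F ^ 'n \<Rightarrow> complex) set \<Rightarrow> ('F ^ 'n \<Rightarrow> complex) set" where
  "fourier_transform \<tau>' = \<tau>' w0"

definition modulation_group ::
  "('F::{field_char_0, complete_space} \<Rightarrow> complex) \<Rightarrow> 'F ^ 'n ^ 'n \<Rightarrow> ('F ^ 'n) measure
     \<Rightarrow> ('F ^ 'n hyp ^ 'n hyp \<Rightarrow> ('F ^ 'n \<Rightarrow> complex) set \<Rightarrow> ('F ^ 'n \<Rightarrow> complex) set)
     \<Rightarrow> (('F ^ 'n \<Rightarrow> complex) set \<Rightarrow> ('F ^ 'n \<Rightarrow> complex) set) set" where
  "modulation_group \<psi> J \<mu> \<tau>' =
     generate (unitary_group \<mu>) ({fourier_transform \<tau>'} \<union> R_image \<psi> J \<mu>)"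

end

theory Submission
  imports Defs
begin

text \<open>
  The operators of the small modulation group are, representative by representative, the operators
  \<open>\<tau>'(n(v) m(a,h))\<close>, so everything reduces to showing that \<open>w\<^sub>0\<close> and the parabolic subgroup
  generate \<open>GO(V\<^sub>k\<^sub>+\<^sub>1)\<close>. The parabolic subgroup is the stabilizer of the isotropic line spanned by the
  last basis vector \<open>e\<close>, and an element \<open>h\<close> is moved into it by looking at its last row
  \<open>e h = (x, v, y)\<close>: if \<open>x \<noteq> 0\<close>, then \<open>n(-v/x)\<close> makes the row \<open>(x, 0, 0)\<close> and \<open>w\<^sub>0\<close> turns this into
  \<open>(0, 0, x)\<close>; if \<open>y \<noteq> 0\<close>, then \<open>w\<^sub>0\<close> leads back to the first case; otherwise \<open>v \<noteq> 0\<close>, and some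
  \<open>n(u)\<close> makes \<open>y\<close> nonzero.
\<close>

section \<open>Images of generated subgroups\<close>

text \<open>Stated for \<open>K\<close> with a restricted carrier because the unitary group is
  defined that way over \<open>BijGroup\<close>. The set \<open>S\<close> is not assumed closed, so
  the generated set is first compared with the one in the group \<open>K\<close>, where
  \<open>generate_img\<close> applies.\<close>

lemma generate_hom_image:
  assumes G: "group G" and K: "group K" and S: "S \<subseteq> carrier K"
    and f: "f \<in> hom G (K\<lparr>carrier := S\<rparr>)" and A: "A \<subseteq> carrier G"
  shows "generate (K\<lparr>carrier := S\<rparr>) (f ` A) = f ` generate G A"
proof -
  have fS: "f x \<in> S" if "x \<in> carrier G" for x
    using f that by (auto simp: hom_def)
  have "f \<in> hom G K"
    using f S by (auto simp: hom_def)
  then interpret group_hom G K f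
    using G K by (simp add: group_hom_def group_hom_axioms_def)
  \<comment> \<open>The inverse in the restricted monoid is a definite description over
    \<open>S\<close>. The inverse in \<open>K\<close> lies in \<open>S\<close>, being the image of
    an inverse in \<open>G\<close>, and uniqueness in \<open>K\<close> settles the
    description.\<close>
  have inv_eq: "inv\<^bsub>K\<lparr>carrier := S\<rparr>\<^esub> (f x) = inv\<^bsub>K\<^esub> (f x)" if x: "x \<in> carrier G" for x
  proof -
    have "inv\<^bsub>K\<^esub> (f x) \<in> S"
      using fS[of "inv\<^bsub>G\<^esub> x"] x by simp
    then show ?thesis
      unfolding m_inv_def[of "K\<lparr>carrier := S\<rparr>"]
      using x S by (intro the_equality) (auto intro: H.inv_unique' sym)
  qed
  have "generate (K\<lparr>carrier := S\<rparr>) (f ` A) = generate K (f ` A)"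
  proof (intro subset_antisym subsetI)
    fix y assume "y \<in> generate (K\<lparr>carrier := S\<rparr>) (f ` A)"
    then show "y \<in> generate K (f ` A)"
    proof induction
      case one
      show ?case using generate.one[of K] by simp
    next
      case (inv y)
      then show ?case using A inv_eq generate.inv[of y "f ` A" K] by auto
    next
      case (eng y z)
      then show ?case using generate.eng[of y K "f ` A" z] by simp
    qed (rule generate.incl)
  next
    fix y assume "y \<in> generate K (f ` A)"
    then show "y \<in> generate (K\<lparr>carrier := S\<rparr>) (f ` A)"
    proof induction
      case one
      show ?case using generate.one[of "K\<lparr>carrier := S\<rparr>"] by simp
    next
      case (inv y)
      then show ?case
        using A inv_eq generate.inv[of y "f ` A" "K\<lparr>carrier := S\<rparr>"] by auto
    next
      case (eng y z)
      then show ?case using generate.eng[of y "K\<lparr>carrier := S\<rparr>" "f ` A" z] by simp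
    qed (rule generate.incl)
  qed
  then show ?thesis
    using generate_img[OF A] by simp
qed

section \<open>Bilinear forms and similitudes of a quadratic space\<close>

lemma form_eq_matrix: "form J v w = (\<Sum>i\<in>UNIV. v $ i * (J *v w) $ i)"
  by (simp add: form_def matrix_vector_mult_def sum_distrib_left mult.assoc)

lemma form_add_left: "form J (u + v) w = form J u w + form J v w"
  by (simp add: form_eq_matrix distrib_right sum.distrib)

lemma form_add_right: "form J u (v + w) = form J u v + form J u w"
  by (simp add: form_eq_matrix algebra_simps sum.distrib)

lemma form_scale_left: "form J (c *s v) w = c * form J v w"
  by (simp add: form_def sum_distrib_left mult.assoc)

lemma form_scale_right: "form J v (c *s w) = c * form J v w"
  by (simp add: form_def sum_distrib_left ac_simps)

lemma form_zero [simp]: "form J 0 w = 0" "form J v 0 = 0"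
  by (simp_all add: form_def)

lemma form_sym:
  assumes "transpose J = J"
  shows "form J v w = form J w v"
proof -
  have "J $ i $ j = J $ j $ i" for i j
    using assms by (auto simp: transpose_def vec_eq_iff)
  then show ?thesis
    unfolding form_def by (subst sum.swap) (simp add: ac_simps)
qed

lemma form_axis_left: "form J (axis i 1) w = (J *v w) $ i"
  by (simp add: form_eq_matrix axis_def if_distrib[of "\<lambda>x. x * _"] cong: if_cong)

lemma form_axis: "form J (axis i 1) (axis j 1) = J $ i $ j"
  unfolding form_axis_left
  by (simp add: matrix_vector_mult_def axis_def if_distrib[of "\<lambda>x. _ * x"] cong: if_cong)

lemma matrix_nth: "(A ** B) $ i = A $ i v* B"
  by (simp add: vec_eq_iff matrix_matrix_mult_def vector_matrix_mult_def)

lemma axis_vector_matrix: "axis i 1 v* g = g $ i"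
  by (simp add: vec_eq_iff vector_matrix_mult_def axis_def if_distrib[of "\<lambda>x. x * _"] cong: if_cong)

text \<open>Change of Gram matrix under pullback; it turns a condition on all vectors into one on
  matrix entries.\<close>

lemma form_vector_matrix:
  fixes J g :: "'F::field ^ 'n ^ 'n"
  shows "form J (v v* g) (w v* g) = form (g ** J ** transpose g) v w"
proof -
  have l: "form A (v v* g) u = form (g ** A) v u" for A g :: "'F ^ 'n ^ 'n" and u
    unfolding form_eq_matrix matrix_vector_mul_assoc[symmetric]
    by (simp add: vector_matrix_mult_def matrix_vector_mult_def[of g] sum_distrib_left sum_distrib_right)
       (subst sum.swap, simp add: ac_simps)
  have "w v* g = transpose g *v w"
    by simp
  then show ?thesis
    unfolding l by (simp only: form_eq_matrix matrix_vector_mul_assoc)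
qed

text \<open>A bilinear form is determined by its values on the standard basis, and \<open>g\<close>
  sends the basis vectors to its rows. This lets similitude relations be read off row by
  row.\<close>

lemma is_similitude_iff:
  fixes J :: "'F::field ^ 'n ^ 'n"
  shows "is_similitude J c g \<longleftrightarrow> c \<noteq> 0 \<and> (\<forall>i j. form J (g $ i) (g $ j) = c * J $ i $ j)"
proof
  assume "is_similitude J c g"
  then show "c \<noteq> 0 \<and> (\<forall>i j. form J (g $ i) (g $ j) = c * J $ i $ j)"
    unfolding is_similitude_def by (metis axis_vector_matrix form_axis)
next
  assume *: "c \<noteq> 0 \<and> (\<forall>i j. form J (g $ i) (g $ j) = c * J $ i $ j)"
  then have "(g ** J ** transpose g) $ i $ j = c * J $ i $ j" for i j
    by (metis axis_vector_matrix form_axis form_vector_matrix)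
  with * show "is_similitude J c g"
    unfolding is_similitude_def form_vector_matrix
    by (simp add: form_def sum_distrib_left ac_simps)
qed

lemma nondegenerate_ex:
  fixes J :: "'F::field ^ 'n ^ 'n"
  assumes J: "nondegenerate J" and "v \<noteq> 0"
  shows "\<exists>w. form J v w \<noteq> 0"
proof (rule ccontr)
  assume "\<not> ?thesis"
  then have "form J (axis i 1) v = 0" for i
    using J by (metis form_sym nondegenerate_def)
  then have "J *v v = 0"
    by (simp add: form_axis_left vec_eq_iff)
  moreover have "invertible J"
    using J by (simp add: nondegenerate_def invertible_det_nz)
  ultimately show False
    using \<open>v \<noteq> 0\<close> by (metis invertible_def matrix_left_invertible_ker)
qed

text \<open>A trivial radical means that \<open>J\<close> has trivial kernel. This gives
  nondegeneracy of the hyperbolic extension without computing a block determinant.\<close>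

lemma nondegenerateI:
  fixes J :: "'F::field ^ 'n ^ 'n"
  assumes "transpose J = J" and "\<And>v. (\<And>w. form J v w = 0) \<Longrightarrow> v = 0"
  shows "nondegenerate J"
proof -
  have "v = 0" if "J *v v = 0" for v
  proof (rule assms(2))
    fix w
    have "form J w v = 0"
      by (simp add: form_eq_matrix that)
    then show "form J v w = 0"
      using form_sym[OF assms(1)] by metis
  qed
  then have "invertible J"
    by (simp add: invertible_left_inverse matrix_left_invertible_ker)
  with assms(1) show ?thesis
    by (simp add: nondegenerate_def invertible_det_nz)
qed

lemma similitude_unique:
  fixes J :: "'F::field ^ 'n ^ 'n"
  assumes J: "nondegenerate J" and "is_similitude J c g" "is_similitude J c' g"
  shows "c = c'"
proof -
  \<comment> \<open>Index types are nonempty, so \<open>undefined\<close> serves as an arbitrary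
    index; one nonzero value of the form then fixes the factor.\<close>
  have "axis undefined 1 \<noteq> (0 :: 'F ^ 'n)"
    by (simp add: axis_eq_0_iff)
  then obtain w where "form J (axis undefined 1) w \<noteq> 0"
    using nondegenerate_ex[OF J] by blast
  with assms(2,3) show ?thesis
    unfolding is_similitude_def by (metis mult_right_cancel)
qed

lemma similitude_norm_eq:
  fixes J :: "'F::field ^ 'n ^ 'n"
  assumes "nondegenerate J" "is_similitude J c g"
  shows "similitude_norm J g = c"
  unfolding similitude_norm_def using assms similitude_unique by blast

lemma similitude_mat:
  fixes J :: "'F::field ^ 'n ^ 'n"
  assumes "l \<noteq> 0"
  shows "is_similitude J (l\<^sup>2) (mat l)"
proof -
  have "v v* mat l = l *s v" for v :: "'F ^ 'n"
    by (simp add: vec_eq_iff vector_matrix_mult_def mat_def if_distrib[of "\<lambda>x. _ * x"] cong: if_cong)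
  then show ?thesis
    using assms by (simp add: is_similitude_def form_scale_left form_scale_right power2_eq_square)
qed

lemma similitude_mult:
  fixes J :: "'F::field ^ 'n ^ 'n"
  assumes "is_similitude J c g" "is_similitude J c' g'"
  shows "is_similitude J (c * c') (g ** g')"
  using assms by (simp add: is_similitude_def vector_matrix_mul_assoc[symmetric] mult.assoc mult.left_commute)

text \<open>A vector killed by \<open>g\<close> would be orthogonal to everything, since
  \<open>g\<close> scales the form by \<open>c \<noteq> 0\<close>. The factor of the inverse follows
  by applying \<open>g\<close> after it.\<close>

lemma similitude_invertible:
  fixes J :: "'F::field ^ 'n ^ 'n"
  assumes J: "nondegenerate J" and g: "is_similitude J c g"
  obtains h where "g ** h = mat 1" "h ** g = mat 1" "is_similitude J (inverse c) h"
proof -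
  have "v = 0" if "transpose g *v v = 0" for v
  proof (rule ccontr)
    assume "v \<noteq> 0"
    then obtain w where "form J v w \<noteq> 0"
      using nondegenerate_ex[OF J] by blast
    moreover have "form J (v v* g) (w v* g) = c * form J v w" "c \<noteq> 0"
      using g by (simp_all add: is_similitude_def)
    ultimately show False
      using that by simp
  qed
  then have "\<exists>h. h ** transpose g = mat 1"
    unfolding matrix_left_invertible_ker by blast
  then obtain h where "h ** transpose g = mat 1" ..
  then have "transpose (h ** transpose g) = mat 1"
    by (simp add: transpose_mat)
  then have gh: "g ** transpose h = mat 1"
    by (simp add: matrix_transpose_mul)
  then have hg: "transpose h ** g = mat 1"
    by (simp add: matrix_left_right_inverse)
  have "is_similitude J (inverse c) (transpose h)"
    unfolding is_similitude_def
  proof (intro conjI allI)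
    show "inverse c \<noteq> 0"
      using g by (simp add: is_similitude_def)
    fix v w
    have "form J ((v v* transpose h) v* g) ((w v* transpose h) v* g)
        = c * form J (v v* transpose h) (w v* transpose h)"
      using g unfolding is_similitude_def by blast
    then show "form J (v v* transpose h) (w v* transpose h) = inverse c * form J v w"
      using \<open>inverse c \<noteq> 0\<close> hg
      by (simp only: vector_matrix_mul_assoc vector_matrix_mul_rid hg) (simp add: field_simps)
  qed
  with gh hg show ?thesis
    using that by blast
qed

lemma GO_simps [simp]:
  "g \<in> carrier (GO J) \<longleftrightarrow> (\<exists>c. is_similitude J c g)"
  "g \<otimes>\<^bsub>GO J\<^esub> h = g ** h" "\<one>\<^bsub>GO J\<^esub> = mat 1"
  by (simp_all add: GO_def)

lemma group_GO:
  fixes J :: "'F::field ^ 'n ^ 'n"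
  assumes J: "nondegenerate J"
  shows "group (GO J)"
proof (rule groupI)
  show "\<one>\<^bsub>GO J\<^esub> \<in> carrier (GO J)"
    using similitude_mat[of 1 J] by auto
next
  fix g assume "g \<in> carrier (GO J)"
  then show "\<exists>h\<in>carrier (GO J). h \<otimes>\<^bsub>GO J\<^esub> g = \<one>\<^bsub>GO J\<^esub>"
    using similitude_invertible[OF J] by (metis GO_simps)
qed (auto simp: matrix_mul_assoc intro: similitude_mult)

section \<open>Coordinates on the orthogonal sum with a hyperbolic plane\<close>

text \<open>The row-vector counterpart of \<open>block\<close>: each row of a block matrix has this
  shape.\<close>

definition hvec :: "'F \<Rightarrow> 'F ^ 'n \<Rightarrow> 'F \<Rightarrow> 'F ^ 'n hyp" where
  "hvec x v y = (\<chi> i. case i of First \<Rightarrow> x | Mid k \<Rightarrow> v $ k | Last \<Rightarrow> y)"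

lemma hvec_nth [simp]: "hvec x v y $ First = x" "hvec x v y $ Mid k = v $ k" "hvec x v y $ Last = y"
  by (simp_all add: hvec_def)

lemma hvec_eq_iff [simp]: "hvec x v y = hvec x' v' y' \<longleftrightarrow> x = x' \<and> v = v' \<and> y = y'"
  by (metis hvec_nth vec_eq_iff)

lemma hvec_cases: obtains x v y where "u = hvec x v y"
proof
  show "u = hvec (u $ First) (\<chi> k. u $ Mid k) (u $ Last)"
    unfolding vec_eq_iff hvec_def by (simp split: hyp.split)
qed

lemma hvec_zero: "hvec 0 0 0 = 0"
  by (simp add: vec_eq_iff hvec_def split: hyp.split)

lemma sum_hyp: "(\<Sum>i\<in>UNIV. f i) = f First + (\<Sum>k\<in>UNIV. f (Mid k)) + f Last"
  for f :: "'n::finite hyp \<Rightarrow> 'a::comm_monoid_add"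
  by (simp add: UNIV_hyp image_iff sum.reindex inj_def ac_simps)

lemma block_nth [simp]:
  "block a11 r12 a13 c21 A22 c23 a31 r32 a33 $ First = hvec a11 r12 a13"
  "block a11 r12 a13 c21 A22 c23 a31 r32 a33 $ Mid k = hvec (c21 $ k) (A22 $ k) (c23 $ k)"
  "block a11 r12 a13 c21 A22 c23 a31 r32 a33 $ Last = hvec a31 r32 a33"
  by (simp_all add: block_def hvec_def vec_eq_iff)

text \<open>Blockwise multiplication; together with \<open>matrix_nth\<close> it reduces matrix
  identities to computations with triples.\<close>

lemma hvec_block:
  "hvec x v y v* block a11 r12 a13 c21 A22 c23 a31 r32 a33 =
     hvec (x * a11 + (\<Sum>k\<in>UNIV. v $ k * c21 $ k) + y * a31)
          (x *s r12 + v v* A22 + y *s r32)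
          (x * a13 + (\<Sum>k\<in>UNIV. v $ k * c23 $ k) + y * a33)"
proof -
  have "(hvec x v y v* block a11 r12 a13 c21 A22 c23 a31 r32 a33) $ i =
     hvec (x * a11 + (\<Sum>k\<in>UNIV. v $ k * c21 $ k) + y * a31)
          (x *s r12 + v v* A22 + y *s r32)
          (x * a13 + (\<Sum>k\<in>UNIV. v $ k * c23 $ k) + y * a33) $ i" for i
    by (cases i) (simp_all add: vector_matrix_mult_def sum_hyp)
  then show ?thesis by (simp add: vec_eq_iff)
qed

lemma form_hyp_ext:
  "form (hyp_ext J) (hvec x v y) (hvec x' v' y') = x * y' + form J v v' + y * x'"
  by (simp add: form_def sum_hyp hyp_ext_def)

lemma hyp_ext_nth:
  "hyp_ext J $ First = hvec 0 0 1"
  "hyp_ext J $ Mid k = hvec 0 (J $ k) 0"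
  "hyp_ext J $ Last = hvec 1 0 0"
  by (simp_all add: hyp_ext_def)

lemma hyp_all: "(\<forall>i. P i) \<longleftrightarrow> P First \<and> (\<forall>k. P (Mid k)) \<and> P Last"
  by (metis hyp.exhaust)

text \<open>The two outer basis vectors are dual to each other, so pairing with them isolates the
  outer coordinates; pairing with the middle summand leaves nondegeneracy of
  \<open>J\<close>.\<close>

lemma nondegenerate_hyp_ext:
  fixes J :: "'F::field ^ 'n ^ 'n"
  assumes J: "nondegenerate J"
  shows "nondegenerate (hyp_ext J)"
proof (rule nondegenerateI)
  have "J $ i $ j = J $ j $ i" for i j
    using J by (auto simp: nondegenerate_def transpose_def vec_eq_iff)
  then show "transpose (hyp_ext J) = hyp_ext J"
    by (simp add: vec_eq_iff transpose_def hyp_all hyp_ext_def)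
next
  fix u assume *: "\<And>w. form (hyp_ext J) u w = 0"
  obtain x v y where u: "u = hvec x v y"
    by (rule hvec_cases)
  have "y = 0"
    using *[of "hvec 1 0 0"] by (simp add: u form_hyp_ext)
  moreover have "x = 0"
    using *[of "hvec 0 0 1"] by (simp add: u form_hyp_ext)
  moreover have "form J v w = 0" for w
    using *[of "hvec 0 w 0"] by (simp add: u form_hyp_ext)
  then have "v = 0"
    using nondegenerate_ex[OF J] by blast
  ultimately show "u = 0"
    by (simp add: u hvec_zero)
qed


section \<open>The elements m(a,g), n(v) and w0 as similitudes\<close>

lemma m_mat_eq:
  fixes J :: "'F::field ^ 'n ^ 'n"
  assumes "nondegenerate J" "is_similitude J c g"
  shows "m_mat J a g = block (a * c) 0 0 0 g 0 0 0 (inverse a)"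
  by (simp add: m_mat_def similitude_norm_eq[OF assms])

lemma hvec_n_mat:
  fixes J :: "'F::field ^ 'n ^ 'n"
  shows "hvec x u y v* n_mat J v = hvec x (x *s v + u) (y - x * qform J v - form J u v)"
  by (simp add: n_mat_def hvec_block form_eq_matrix sum_negf)

lemma hvec_w0: "hvec x v y v* w0 = hvec y v x"
  by (simp add: w0_def hvec_block)

lemma hvec_m_mat:
  fixes J :: "'F::field ^ 'n ^ 'n"
  assumes "nondegenerate J" "is_similitude J c g"
  shows "hvec x v y v* m_mat J a g = hvec (x * a * c) (v v* g) (y * inverse a)"
  by (simp add: m_mat_eq[OF assms] hvec_block ac_simps)

lemma form_self: "form J v v = 2 * qform J v"
  for J :: "'F::field_char_0 ^ 'n ^ 'n"
  by (simp add: qform_def)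

lemma similitude_hyp_extI:
  assumes "c \<noteq> 0"
    and "\<And>x v y x' v' y'. form (hyp_ext J) (hvec x v y v* g) (hvec x' v' y' v* g)
           = c * form (hyp_ext J) (hvec x v y) (hvec x' v' y')"
  shows "is_similitude (hyp_ext J) c g"
  unfolding is_similitude_def using assms by (metis hvec_cases)

lemma similitude_w0: "is_similitude (hyp_ext J) 1 w0"
  by (rule similitude_hyp_extI) (simp_all add: hvec_w0 form_hyp_ext)

text \<open>The cross terms cancel by symmetry of \<open>J\<close>, and the terms in
  \<open>x * x'\<close> cancel because \<open>form J v v\<close> is twice
  \<open>qform J v\<close>.\<close>

lemma similitude_n_mat:
  fixes J :: "'F::field_char_0 ^ 'n ^ 'n"
  assumes J: "nondegenerate J"
  shows "is_similitude (hyp_ext J) 1 (n_mat J v)"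
proof (rule similitude_hyp_extI)
  fix x u y x' u' y'
  show "form (hyp_ext J) (hvec x u y v* n_mat J v) (hvec x' u' y' v* n_mat J v)
      = 1 * form (hyp_ext J) (hvec x u y) (hvec x' u' y')"
    using J by (simp add: hvec_n_mat form_hyp_ext form_add_left form_add_right form_scale_left
        form_scale_right form_self form_sym[of J v] nondegenerate_def algebra_simps)
qed simp

text \<open>The outer scalars \<open>a * c\<close> and \<open>inverse a\<close> multiply to
  \<open>c\<close>, the factor of \<open>g\<close> on the middle summand.\<close>

lemma similitude_m_mat:
  fixes J :: "'F::field ^ 'n ^ 'n"
  assumes J: "nondegenerate J" and g: "is_similitude J c g" and "a \<noteq> 0"
  shows "is_similitude (hyp_ext J) c (m_mat J a g)"
proof (rule similitude_hyp_extI)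
  show "c \<noteq> 0"
    using g by (simp add: is_similitude_def)
  fix x v y x' v' y'
  show "form (hyp_ext J) (hvec x v y v* m_mat J a g) (hvec x' v' y' v* m_mat J a g)
      = c * form (hyp_ext J) (hvec x v y) (hvec x' v' y')"
    using g \<open>a \<noteq> 0\<close>
    by (simp add: hvec_m_mat[OF J g] form_hyp_ext is_similitude_def) (simp add: field_simps)
qed

section \<open>The parabolic subgroup, and generation of the similitude group\<close>

text \<open>A plain set, with the factors in the order in which \<open>similitude_extension\<close>
  prescribes the operator.\<close>

definition parabolic :: "'F::field ^ ('n::finite) ^ 'n \<Rightarrow> ('F ^ 'n hyp ^ 'n hyp) set" where
  "parabolic J = {n_mat J v ** m_mat J a g | v a g. a \<noteq> 0 \<and> g \<in> carrier (GO J)}"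

lemma parabolic_subset:
  fixes J :: "'F::field_char_0 ^ 'n ^ 'n"
  assumes J: "nondegenerate J"
  shows "parabolic J \<subseteq> carrier (GO (hyp_ext J))"
  using similitude_mult[OF similitude_n_mat[OF J] similitude_m_mat[OF J]]
  by (fastforce simp: parabolic_def)

lemma hyp_matrix_eqI:
  fixes A B :: "'F::field ^ ('n::finite) hyp ^ 'n hyp"
  assumes "A $ First = B $ First" "\<And>k. A $ Mid k = B $ Mid k" "A $ Last = B $ Last"
  shows "A = B"
  unfolding vec_eq_iff[of A B] hyp_all using assms by simp

text \<open>The relations among the rows of a similitude determine the rest: pairing with the last
  row fixes \<open>\<alpha>\<close> and clears the first column of the middle rows, the middle block
  is a similitude of \<open>J\<close>, and the remaining last-column entries follow from pairings
  with the first row.\<close>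

lemma parabolicI:
  fixes J :: "'F::field_char_0 ^ 'n ^ 'n"
  assumes J: "nondegenerate J" and h: "is_similitude (hyp_ext J) c h"
    and last: "h $ Last = hvec 0 0 z"
  shows "h \<in> parabolic J"
proof -
  obtain \<alpha> u \<beta> where first: "h $ First = hvec \<alpha> u \<beta>"
    by (rule hvec_cases)
  have "\<forall>k. \<exists>p q s. h $ Mid k = hvec p q s"
    by (meson hvec_cases)
  then obtain p q s where mid: "\<And>k. h $ Mid k = hvec (p k) (q k) (s k)"
    by metis
  have c: "c \<noteq> 0"
    and rows: "\<And>i j. form (hyp_ext J) (h $ i) (h $ j) = c * hyp_ext J $ i $ j"
    using h by (auto simp: is_similitude_iff)
  have az: "\<alpha> * z = c"
    using rows[of First Last] by (simp add: first last form_hyp_ext hyp_ext_nth)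
  then have z: "z \<noteq> 0" and \<alpha>: "\<alpha> \<noteq> 0"
    using c by auto
  have p: "p k = 0" for k
    using rows[of "Mid k" Last] z by (simp add: mid last form_hyp_ext hyp_ext_nth)
  define g where "g = (\<chi> k. q k)"
  have "form J (g $ k) (g $ l) = c * J $ k $ l" for k l
    using rows[of "Mid k" "Mid l"] by (simp add: mid p form_hyp_ext hyp_ext_nth g_def)
  then have g: "is_similitude J c g"
    using c by (simp add: is_similitude_iff)
  \<comment> \<open>The first row of n(v) m(a,g) has middle part \<open>v v* g\<close>, so
    \<open>v\<close> has to be the preimage of \<open>u\<close> under \<open>g\<close>.\<close>
  then obtain g' where "g' ** g = mat 1"
    using similitude_invertible[OF J] by metis
  then have "(u v* g') v* g = u"
    by (simp add: vector_matrix_mul_assoc)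
  then obtain v where v: "v v* g = u"
    by blast
  have q: "axis k 1 v* g = q k" for k
    by (simp add: axis_vector_matrix g_def)
  \<comment> \<open>Isotropy of the first row determines \<open>\<beta>\<close>; writing
    \<open>c\<close> as \<open>\<alpha> * z\<close> makes \<open>\<alpha>\<close> cancel.\<close>
  have "2 * (\<alpha> * \<beta> + qform J u) = 0"
    using rows[of First First] unfolding first form_hyp_ext
    by (simp add: hyp_ext_nth form_self algebra_simps)
  then have "\<alpha> * \<beta> + qform J u = 0"
    unfolding mult_eq_0_iff by simp
  moreover have "qform J u = c * qform J v"
    using g v by (metis is_similitude_def qform_def times_divide_eq_right)
  ultimately have "\<alpha> * (\<beta> + z * qform J v) = 0"
    by (simp add: az[symmetric] algebra_simps)
  then have \<beta>: "\<beta> = - (z * qform J v)"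
    using \<alpha> by (simp add: eq_neg_iff_add_eq_0)
  \<comment> \<open>Orthogonality of the first row to the middle rows determines the last
    column.\<close>
  have s: "s k = - (z * (J *v v) $ k)" for k
  proof -
    have "form J (axis k 1 v* g) (v v* g) = c * form J (axis k 1) v"
      using g by (simp add: is_similitude_def)
    then have "form J (q k) u = c * (J *v v) $ k"
      by (simp add: q form_axis_left v)
    moreover have "form J (q k) u + s k * \<alpha> = 0"
      using rows[of "Mid k" First] by (simp add: first mid p form_hyp_ext hyp_ext_nth)
    ultimately have "\<alpha> * (s k + z * (J *v v) $ k) = 0"
      by (simp add: az[symmetric] algebra_simps)
    then show ?thesis
      using \<alpha> by (simp add: eq_neg_iff_add_eq_0)
  qed
  \<comment> \<open>The corner entry \<open>inverse a\<close> of m(a,g) must be \<open>z\<close>,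
    whence the argument \<open>inverse z\<close>.\<close>
  have "h = n_mat J v ** m_mat J (inverse z) g"
  proof (rule hyp_matrix_eqI)
    show "h $ First = (n_mat J v ** m_mat J (inverse z) g) $ First"
      using az z v by (simp add: matrix_nth first n_mat_def hvec_m_mat[OF J g] \<beta> field_simps)
    have "(mat 1 :: 'F ^ 'n ^ 'n) $ k = axis k 1" for k
      by (auto simp: vec_eq_iff mat_def axis_def)
    then show "h $ Mid k = (n_mat J v ** m_mat J (inverse z) g) $ Mid k" for k
      by (simp add: matrix_nth mid p s q n_mat_def hvec_m_mat[OF J g])
    show "h $ Last = (n_mat J v ** m_mat J (inverse z) g) $ Last"
      by (simp add: matrix_nth last n_mat_def hvec_m_mat[OF J g])
  qed
  moreover have "inverse z \<noteq> 0" "g \<in> carrier (GO J)"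
    using z g by auto
  ultimately show ?thesis
    unfolding parabolic_def by blast
qed

lemma generate_w0_parabolic:
  fixes J :: "'F::field_char_0 ^ 'n ^ 'n"
  assumes J: "nondegenerate J"
  shows "generate (GO (hyp_ext J)) (insert w0 (parabolic J)) = carrier (GO (hyp_ext J))"
    (is "?S = carrier ?G")
proof
  interpret group ?G
    by (intro group_GO nondegenerate_hyp_ext J)
  have sub: "insert w0 (parabolic J) \<subseteq> carrier ?G"
    using parabolic_subset[OF J] similitude_w0[of J] by auto
  then show "?S \<subseteq> carrier ?G"
    by (rule generate_incl)
  have S: "subgroup ?S ?G"
    by (rule generate_is_subgroup[OF sub])
  \<comment> \<open>The last row of n(v) is (0,0,1), so \<open>parabolicI\<close> applies with
    \<open>z\<close> equal to 1.\<close>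
  have n: "n_mat J v \<in> ?S" for v
    using parabolicI[OF J similitude_n_mat[OF J]] by (intro generate.incl) (simp add: n_mat_def)
  have w: "w0 \<in> ?S"
    by (intro generate.incl) simp
  \<comment> \<open>All reductions multiply on the right by elements of the generated subgroup; this
    undoes them.\<close>
  have cancel: "h \<in> ?S" if "h \<in> carrier ?G" "x \<in> ?S" "h ** x \<in> ?S" for h x
  proof -
    have x: "x \<in> carrier ?G"
      using S that(2) by (rule subgroup.mem_carrier)
    have "h ** x \<otimes>\<^bsub>?G\<^esub> inv\<^bsub>?G\<^esub> x \<in> ?S"
      using S that by (intro subgroup.m_closed subgroup.m_inv_closed)
    also have "h ** x \<otimes>\<^bsub>?G\<^esub> inv\<^bsub>?G\<^esub> x = h"
      using m_assoc[OF that(1) x inv_closed[OF x]] r_inv[OF x] r_one[OF that(1)] by simp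
    finally show ?thesis .
  qed
  have closed: "h ** x \<in> carrier ?G" if "h \<in> carrier ?G" "x \<in> ?S" for h x
    using m_closed[OF that(1) subgroup.mem_carrier[OF S that(2)]] by simp
  have step1: "h \<in> ?S" if h: "h \<in> carrier ?G" and "h $ Last = hvec x v y" "x \<noteq> 0" for h x v y
  proof -
    have last: "(h ** n_mat J (- inverse x *s v)) $ Last
        = hvec x 0 (y - x * qform J (- inverse x *s v) - form J v (- inverse x *s v))"
      (is "?h $ Last = hvec x 0 ?y")
      using that by (simp add: matrix_nth hvec_n_mat vector_smult_assoc)
    have "?h \<in> carrier ?G"
      using closed h n by blast
    then obtain c where c: "is_similitude (hyp_ext J) c ?h"
      by auto
    \<comment> \<open>The last basis vector is isotropic, hence so is the last row of a similitude.
      For a row (x, 0, y') this says 2xy' = 0, so clearing the middle part also clears the last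
      entry.\<close>
    then have "form (hyp_ext J) (?h $ Last) (?h $ Last) = 0"
      by (simp add: is_similitude_iff hyp_ext_nth)
    then have "2 * (x * ?y) = 0"
      unfolding last form_hyp_ext by (simp add: algebra_simps)
    then have "?y = 0"
      using \<open>x \<noteq> 0\<close> by simp
    then have "(?h ** w0) $ Last = hvec 0 0 x"
      by (simp only: matrix_nth[of ?h] last hvec_w0)
    then have "?h ** w0 \<in> ?S"
      using parabolicI[OF J similitude_mult[OF c similitude_w0]] by (intro generate.incl) blast
    then show ?thesis
      using cancel[OF _ w] cancel[OF h n] \<open>?h \<in> carrier ?G\<close> by blast
  qed
  have step2: "h \<in> ?S" if h: "h \<in> carrier ?G" and "h $ Last = hvec x v y" "y \<noteq> 0" for h x v y
  proof -
    have "(h ** w0) $ Last = hvec y v x"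
      using that by (simp add: matrix_nth hvec_w0)
    then show ?thesis
      using step1[OF closed[OF h w]] \<open>y \<noteq> 0\<close> cancel[OF h w] by blast
  qed
  show "carrier ?G \<subseteq> ?S"
  proof
    fix h assume h: "h \<in> carrier ?G"
    obtain x v y where last: "h $ Last = hvec x v y"
      by (rule hvec_cases)
    consider "x \<noteq> 0" | "y \<noteq> 0" | "v \<noteq> 0" "x = 0" "y = 0" | "h $ Last = 0"
      using last hvec_zero by metis
    then show "h \<in> ?S"
    proof cases
      case 3
      \<comment> \<open>With both outer coordinates zero, n(u) puts \<open>- form J v u\<close> in
        the last place, which nondegeneracy makes nonzero for a suitable \<open>u\<close>.\<close>
      then obtain u where "form J v u \<noteq> 0"
        using nondegenerate_ex[OF J] by blast
      moreover have "(h ** n_mat J u) $ Last = hvec 0 v (- form J v u)"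
        using last 3 by (simp add: matrix_nth hvec_n_mat)
      ultimately have "h ** n_mat J u \<in> ?S"
        using step2[OF closed[OF h n]] by (metis neg_equal_0_iff_equal)
      then show ?thesis
        using cancel[OF h n] by blast
    next
      \<comment> \<open>A zero last row is impossible: its pairing with the first row must be
        \<open>c\<close> times the entry 1 of the Gram matrix.\<close>
      case 4
      moreover obtain c where "is_similitude (hyp_ext J) c h"
        using h by auto
      ultimately have "c * hyp_ext J $ Last $ First = 0" "c \<noteq> 0"
        by (metis form_zero(1) is_similitude_iff)+
      then show ?thesis
        by (simp add: hyp_ext_nth)
    qed (use step1 step2 h last in blast)+
  qed
qed

section \<open>The small modulation group and its operators\<close>

lemma mem_Psi_pre: "(v, a, h) \<in> carrier (Psi_pre J) \<longleftrightarrow> a \<noteq> 0 \<and> h \<in> carrier (GO J)"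
  by (simp add: Psi_pre_def)

text \<open>\<open>R_image\<close> runs over all representatives of all cosets, so what matters is
  their union. Multiplying by \<open>H_X\<close> stays inside the carrier because nonzero scalar
  matrices are similitudes.\<close>

lemma Union_carrier_Psi_small:
  fixes J :: "'F::field ^ 'n ^ 'n"
  assumes J: "nondegenerate J"
  shows "\<Union> (carrier (Psi_small J)) = carrier (Psi_pre J)"
proof (intro subset_antisym subsetI)
  fix x assume "x \<in> \<Union> (carrier (Psi_small J))"
  then obtain l y where "l \<noteq> 0" "y \<in> carrier (Psi_pre J)"
    and x: "x = (0, inverse l, mat l) \<otimes>\<^bsub>Psi_pre J\<^esub> y"
    by (auto simp: Psi_small_def FactGroup_def RCOSETS_def r_coset_def H_X_def)
  moreover obtain v a h where y: "y = (v, a, h)"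
    by (cases y)
  ultimately have "a \<noteq> 0" "h \<in> carrier (GO J)"
    by (simp_all add: mem_Psi_pre)
  then have "mat l ** h \<in> carrier (GO J)"
    using similitude_mult[OF similitude_mat[OF \<open>l \<noteq> 0\<close>]] by auto
  then show "x \<in> carrier (Psi_pre J)"
    using \<open>l \<noteq> 0\<close> \<open>a \<noteq> 0\<close> by (simp add: x y Psi_pre_def)
next
  fix x assume x: "x \<in> carrier (Psi_pre J)"
  \<comment> \<open>The element of \<open>H_X\<close> with \<open>l = 1\<close> is a left identity,
    so \<open>x\<close> lies in its own coset.\<close>
  have "matrix_inv (mat 1 :: 'F ^ 'n ^ 'n) = mat 1"
    by (simp add: matrix_inv_def)
  moreover have "similitude_norm J (mat 1) = 1"
    using similitude_norm_eq[OF J similitude_mat[of 1]] by simp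
  ultimately have "(0, inverse 1, mat 1) \<otimes>\<^bsub>Psi_pre J\<^esub> x = x"
    by (cases x) (simp add: Psi_pre_def)
  moreover have "(0, inverse 1, mat 1) \<in> (H_X :: (('F ^ 'n) \<times> 'F \<times> ('F ^ 'n ^ 'n)) set)"
    unfolding H_X_def using one_neq_zero by blast
  ultimately have "x \<in> H_X #>\<^bsub>Psi_pre J\<^esub> x"
    unfolding r_coset_def by force
  then show "x \<in> \<Union> (carrier (Psi_small J))"
    using x by (auto simp: Psi_small_def FactGroup_def RCOSETS_def)
qed

theorem theorem7p5:
  fixes J :: "'F::{field_char_0, complete_space} ^ 'n::finite ^ 'n"
    and \<psi> :: "'F \<Rightarrow> complex"
    and \<nu> :: "'F measure"
    and \<mu> :: "('F ^ 'n) measure"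
    and \<tau> \<tau>' :: "'F ^ 'n hyp ^ 'n hyp \<Rightarrow> ('F ^ 'n \<Rightarrow> complex) set \<Rightarrow> ('F ^ 'n \<Rightarrow> complex) set"
  assumes field: "nonarch_local_field TYPE('F) \<or> is_real_field TYPE('F)"
    and psi: "additive_character \<psi>" "\<exists>x. \<psi> x \<noteq> 1"
    and J: "nondegenerate J" "even CARD('n)"
    and nonarch: "nonarch_local_field TYPE('F) \<Longrightarrow> 6 \<le> CARD('n)"
      "nonarch_local_field TYPE('F) \<Longrightarrow> real CARD('n) / 2 \<le> real (witt_index (hyp_ext J))"
    and haar: "haar_measure \<nu>"
    and mu: "cone_measure \<nu> J \<mu>"
    and tau: "minimal_rep \<psi> J \<mu> \<tau>"
    and tau': "similitude_extension \<psi> J \<mu> \<tau> \<tau>'"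
  shows "modulation_group \<psi> J \<mu> \<tau>' = \<tau>' ` carrier (GO (hyp_ext J))"
proof -
  have "R_image \<psi> J \<mu> = (\<lambda>x. l2_operator \<mu> (act \<psi> J x)) ` carrier (Psi_pre J)"
    unfolding R_image_def Union_carrier_Psi_small[OF J(1), symmetric] by blast
  \<comment> \<open>The triple (v, a, g) corresponds to n(v) m(a,g), for which
    \<open>similitude_extension\<close> gives the same formula \<open>act\<close>.\<close>
  also have "\<dots> = \<tau>' ` parabolic J"
  proof (intro subset_antisym image_subsetI)
    fix x assume "x \<in> carrier (Psi_pre J)"
    moreover obtain v a g where x: "x = (v, a, g)"
      by (cases x)
    ultimately have "a \<noteq> 0" "g \<in> carrier (GO J)"
      by (simp_all add: mem_Psi_pre)
    then have "l2_operator \<mu> (act \<psi> J x) = \<tau>' (n_mat J v ** m_mat J a g)"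
      using tau' unfolding similitude_extension_def x by metis
    then show "l2_operator \<mu> (act \<psi> J x) \<in> \<tau>' ` parabolic J"
      using \<open>a \<noteq> 0\<close> \<open>g \<in> carrier (GO J)\<close> unfolding parabolic_def by blast
  next
    fix h assume "h \<in> parabolic J"
    then obtain v a g where h: "h = n_mat J v ** m_mat J a g" and "a \<noteq> 0" "g \<in> carrier (GO J)"
      unfolding parabolic_def by blast
    then have "\<tau>' h = l2_operator \<mu> (act \<psi> J (v, a, g))"
      using tau' unfolding similitude_extension_def by metis
    moreover have "(v, a, g) \<in> carrier (Psi_pre J)"
      using \<open>a \<noteq> 0\<close> \<open>g \<in> carrier (GO J)\<close> by (simp add: mem_Psi_pre)
    ultimately show "\<tau>' h \<in> (\<lambda>x. l2_operator \<mu> (act \<psi> J x)) ` carrier (Psi_pre J)"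
      by blast
  qed
  finally have "modulation_group \<psi> J \<mu> \<tau>'
      = generate (unitary_group \<mu>) (\<tau>' ` insert w0 (parabolic J))"
    by (simp add: modulation_group_def fourier_transform_def)
  also have "\<dots> = \<tau>' ` generate (GO (hyp_ext J)) (insert w0 (parabolic J))"
    \<comment> \<open>This exposes \<open>BijGroup\<close> with a restricted carrier, so that
      \<open>K\<close> can be the group of all bijections of \<open>L2 \<mu>\<close>.\<close>
    unfolding unitary_group_def
  proof (rule generate_hom_image)
    show "group (GO (hyp_ext J))"
      by (intro group_GO nondegenerate_hyp_ext J)
    show "group (BijGroup (L2 \<mu>))"
      by (rule group_BijGroup)
    show "\<tau>' \<in> hom (GO (hyp_ext J)) (BijGroup (L2 \<mu>)\<lparr>carrier := {T \<in> Bij (L2 \<mu>).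
       (\<forall>X\<in>L2 \<mu>. \<forall>Y\<in>L2 \<mu>. T (l2_add \<mu> X Y) = l2_add \<mu> (T X) (T Y)) \<and>
       (\<forall>z. \<forall>X\<in>L2 \<mu>. T (l2_scale \<mu> z X) = l2_scale \<mu> z (T X)) \<and>
       (\<forall>X\<in>L2 \<mu>. \<forall>Y\<in>L2 \<mu>. l2_inner \<mu> (T X) (T Y) = l2_inner \<mu> X Y)}\<rparr>)"
      using tau' by (simp add: similitude_extension_def unitary_rep_def unitary_group_def)
    show "insert w0 (parabolic J) \<subseteq> carrier (GO (hyp_ext J))"
      using parabolic_subset[OF J(1)] similitude_w0[of J] by auto
  qed (auto simp: BijGroup_def)
  also have "\<dots> = \<tau>' ` carrier (GO (hyp_ext J))"
    by (simp only: generate_w0_parabolic[OF J(1)])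
  finally show ?thesis .
qed

end
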